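(* Suppose that $K$ is a finite abelian group and $e:K\times K\to U(1)$ is a non-degenerate alternating bicharacter. Then there exist a finite abelian group $A$ and an isomorphism $\phi:A\times\hat{A}\to K$ such that $$e(\phi(x,\chi),\phi(x',\chi'))=\chi'(x)\,\chi(x')^{-1}\quad\text{for all }x,x'\in A\text{ and }\chi,\chi'\in\hat{A}.$$
   Context: $U(1)=\{z\in\mathbb{C} : |z|=1\}$, and $\hat{A}$ denotes the Pontryagin dual of $A$, i.e. the group of homomorphisms $A\to U(1)$. A map $e:K\times K\to U(1)$ is an alternating bicharacter if it is a homomorphism in each variable separately and $e(k,k)=1$ for all $k\in K$. It is non-degenerate if the homomorphism $e^\flat:K\to\hat{K}$ given by $(e^\flat(l))(k)=e(k,l)$ is an isomorphism. *)

theory Defs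
  imports Complex_Main "HOL-Algebra.Algebra"
begin

definition U1 :: "complex monoid"
  where "U1 = \<lparr>carrier = {z. cmod z = 1}, monoid.mult = (*), monoid.one = 1\<rparr>"

text \<open>
  The set \<open>hom A U1\<close> only constrains a function on \<open>carrier A\<close>. Restricting to functions
  that are \<open>undefined\<close> off the carrier makes each character a single element of the dual.
\<close>

definition dual_group :: "('a, 'b) monoid_scheme \<Rightarrow> ('a \<Rightarrow> complex) monoid"
  where "dual_group A =
    \<lparr>carrier = hom A U1 \<inter> extensional (carrier A),
     monoid.mult = (\<lambda>\<chi> \<psi>. \<lambda>x\<in>carrier A. \<chi> x \<otimes>\<^bsub>U1\<^esub> \<psi> x),
     monoid.one = (\<lambda>x\<in>carrier A. \<one>\<^bsub>U1\<^esub>)\<rparr>"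

definition bicharacter :: "('a, 'b) monoid_scheme \<Rightarrow> ('a \<Rightarrow> 'a \<Rightarrow> complex) \<Rightarrow> bool"
  where "bicharacter K e \<longleftrightarrow>
    (\<forall>l\<in>carrier K. (\<lambda>k. e k l) \<in> hom K U1) \<and> (\<forall>k\<in>carrier K. (\<lambda>l. e k l) \<in> hom K U1)"

definition alternating_bicharacter :: "('a, 'b) monoid_scheme \<Rightarrow> ('a \<Rightarrow> 'a \<Rightarrow> complex) \<Rightarrow> bool"
  where "alternating_bicharacter K e \<longleftrightarrow>
    bicharacter K e \<and> (\<forall>k\<in>carrier K. e k k = \<one>\<^bsub>U1\<^esub>)"

definition flat :: "('a, 'b) monoid_scheme \<Rightarrow> ('a \<Rightarrow> 'a \<Rightarrow> complex) \<Rightarrow> 'a \<Rightarrow> 'a \<Rightarrow> complex"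
  where "flat K e l = (\<lambda>k\<in>carrier K. e k l)"

definition nondegenerate :: "('a, 'b) monoid_scheme \<Rightarrow> ('a \<Rightarrow> 'a \<Rightarrow> complex) \<Rightarrow> bool"
  where "nondegenerate K e \<longleftrightarrow> flat K e \<in> iso K (dual_group K)"

lemma comm_group_U1: "comm_group U1"
proof (rule comm_groupI)
  fix x assume "x \<in> carrier U1"
  then show "\<exists>y\<in>carrier U1. y \<otimes>\<^bsub>U1\<^esub> x = \<one>\<^bsub>U1\<^esub>"
    by (intro bexI[of _ "inverse x"]) (auto simp: U1_def norm_inverse intro!: left_inverse)
qed (auto simp: U1_def norm_mult)

lemma comm_group_dual_group:
  assumes "group A"
  shows "comm_group (dual_group A)"
proof -
  interpret A: group A by fact
  show ?thesis
  proof (rule comm_groupI)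
    fix x assume x: "x \<in> carrier (dual_group A)"
    then have nz: "x a \<noteq> 0" if "a \<in> carrier A" for a
      using that by (force simp: dual_group_def hom_def U1_def)
    show "\<exists>y\<in>carrier (dual_group A). y \<otimes>\<^bsub>dual_group A\<^esub> x = \<one>\<^bsub>dual_group A\<^esub>"
      by (rule bexI[of _ "\<lambda>a\<in>carrier A. inverse (x a)"])
        (use x nz in \<open>auto simp: dual_group_def hom_def U1_def norm_inverse Pi_iff
          intro!: restrict_ext\<close>)
  next
    fix x assume "x \<in> carrier (dual_group A)"
    then show "\<one>\<^bsub>dual_group A\<^esub> \<otimes>\<^bsub>dual_group A\<^esub> x = x"
      by (auto simp: dual_group_def U1_def extensional_def restrict_def)
  qed (auto simp: dual_group_def hom_def U1_def norm_mult Pi_iff ac_simps intro!: restrict_ext)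
qed

end

theory Submission
  imports Defs
begin

text \<open>
  Call two elements of \<open>K\<close> orthogonal if \<open>e\<close> takes the value \<open>1\<close> on them.  It suffices to write
  \<open>K = A B\<close> with subgroups \<open>A\<close> and \<open>B\<close> that are isotropic, that is, orthogonal to themselves.
  An element of \<open>A \<inter> B\<close> is then orthogonal to everything, hence trivial, so \<open>K = A \<times> B\<close>.
  Moreover \<open>b \<mapsto> e(-, b)\<close> is an isomorphism from \<open>B\<close> to the dual of \<open>A\<close>: an element of its kernel
  is orthogonal to \<open>A\<close> and to \<open>B\<close>, and a character of \<open>A\<close>, extended by \<open>1\<close> on \<open>B\<close>, is \<open>e(-, a b)\<close>
  for some \<open>a\<close> and \<open>b\<close>, whose restriction to \<open>A\<close> is \<open>e(-, b)\<close>.  With \<open>b\<^sub>\<chi>\<close> the preimage of \<open>\<chi>\<close>, the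
  map \<open>(x, \<chi>) \<mapsto> x b\<^sub>\<chi>\<close> has the required property, because
  \<open>e(x b\<^sub>\<chi>, x' b\<^sub>\<chi>') = e(x, b\<^sub>\<chi>') e(b\<^sub>\<chi>, x') = \<chi>'(x) \<chi>(x')\<inverse>\<close>.

  To find \<open>A\<close> and \<open>B\<close>, split off one hyperbolic pair at a time.  Suppose that \<open>K = A B P\<close> with
  \<open>A\<close> and \<open>B\<close> isotropic and orthogonal to the subgroup \<open>P\<close>; initially \<open>A = B = 1\<close> and \<open>P = K\<close>.
  If \<open>P\<close> is not trivial, choose \<open>x \<in> P\<close> such that the group of values \<open>e(x, P)\<close> is as large as
  possible, say of order \<open>m\<close>.  A finite subgroup of the circle of order \<open>m\<close> consists of all the
  \<open>m\<close>-th roots of unity, so there is \<open>y \<in> P\<close> for which \<open>\<zeta> = e(x, y)\<close> is a primitive one.  The group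
  \<open>e(y, P)\<close> contains the inverse of \<open>\<zeta>\<close>, so by the choice of \<open>x\<close> it has the same order and is also
  generated by \<open>\<zeta>\<close>.  Every \<open>p \<in> P\<close> can therefore be multiplied by powers of \<open>x\<close> and \<open>y\<close> so that it
  becomes orthogonal to both.  Thus \<open>x\<close> can be moved into \<open>A\<close> and \<open>y\<close> into \<open>B\<close> if \<open>P\<close> is replaced by
  its elements orthogonal to \<open>x\<close> and \<open>y\<close>.  This subgroup is smaller because \<open>\<zeta> \<noteq> 1\<close>: an element of
  \<open>P\<close> orthogonal to \<open>P\<close> is orthogonal to \<open>K\<close>, so \<open>e\<close> is not constantly \<open>1\<close> on a nontrivial \<open>P\<close>.  As the
  subgroups \<open>A\<close>, \<open>B\<close>, \<open>P\<close> are only required to have product \<open>K\<close>, no directness has to be carried along: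
  it comes at the end from the non-degeneracy.
\<close>

section \<open>Finite subgroups of the circle\<close>

lemma nat_pow_U1: "z [^]\<^bsub>U1\<^esub> (n::nat) = z ^ n"
  by (induction n) (simp_all add: U1_def nat_pow_def)

text \<open>
  Lagrange's theorem puts the \<open>m\<close> elements of a subgroup of order \<open>m\<close> among the solutions of
  \<open>z ^ m = 1\<close>, and there are only \<open>m\<close> of these.
\<close>

lemma finite_subgroup_U1_eq_roots_unity:
  assumes "subgroup S U1" and "finite S"
  shows "S = {z. z ^ card S = 1}"
proof (rule card_subset_eq)
  interpret U: comm_group U1 by (rule comm_group_U1)
  interpret S: group "U1\<lparr>carrier := S\<rparr>"
    by (rule U.subgroup_imp_group[OF assms(1)])
  have pos: "0 < card S"
    using assms subgroup.one_closed card_gt_0_iff by fastforce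
  show "finite {z::complex. z ^ card S = 1}"
    using pos by (intro finite_roots_unity) simp
  show "S \<subseteq> {z. z ^ card S = 1}"
  proof
    fix z assume "z \<in> S"
    then have "z [^]\<^bsub>U1\<lparr>carrier := S\<rparr>\<^esub> card S = \<one>\<^bsub>U1\<^esub>"
      using S.pow_order_eq_1[of z] by (simp add: order_def)
    then show "z \<in> {z. z ^ card S = 1}"
      using U.nat_pow_consistent[of z "card S" S] nat_pow_U1[of z "card S"] by (simp add: U1_def)
  qed
  show "card S = card {z::complex. z ^ card S = 1}"
    using pos by (simp add: card_roots_unity_eq)
qed

lemma primitive_root_unity_exists:
  assumes "0 < (m::nat)"
  shows "\<exists>\<zeta>::complex. \<zeta> ^ m = 1 \<and> (\<forall>z. z ^ m = 1 \<longrightarrow> (\<exists>i::nat. z = \<zeta> ^ i))"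
proof -
  define \<zeta> where "\<zeta> = cis (2 * pi / m)"
  have pow: "\<zeta> ^ i = cis (2 * pi * i / m)" for i :: nat
    by (simp add: \<zeta>_def DeMoivre mult_ac)
  have "\<zeta> ^ m = 1"
    using assms by (simp add: pow)
  moreover have "\<exists>i::nat. z = \<zeta> ^ i" if "z ^ m = 1" for z
  proof -
    have "z \<in> (\<lambda>k. cis (2 * pi * real k / real m)) ` {..<m}"
      using bij_betw_imp_surj_on[OF bij_betw_roots_unity[OF assms]] that by simp
    then show ?thesis
      by (auto simp: pow)
  qed
  ultimately show ?thesis
    by blast
qed

section \<open>Orthogonality for an alternating bicharacter\<close>

locale finite_symplectic_group = comm_group K
  for K :: "('a, 'b) monoid_scheme" (structure) and e :: "'a \<Rightarrow> 'a \<Rightarrow> complex" +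
  assumes finite_carrier: "finite (carrier K)"
    and alternating: "alternating_bicharacter K e"
    and nondeg: "nondegenerate K e"
begin

lemma hom_left: "l \<in> carrier K \<Longrightarrow> (\<lambda>k. e k l) \<in> hom K U1"
  and hom_right: "k \<in> carrier K \<Longrightarrow> e k \<in> hom K U1"
  using alternating by (auto simp: alternating_bicharacter_def bicharacter_def)

lemma e_self [simp]: "k \<in> carrier K \<Longrightarrow> e k k = 1"
  using alternating by (auto simp: alternating_bicharacter_def U1_def)

lemma e_mult_left [simp]:
  "\<lbrakk>k \<in> carrier K; k' \<in> carrier K; l \<in> carrier K\<rbrakk> \<Longrightarrow> e (k \<otimes> k') l = e k l * e k' l"
  using hom_left[of l] by (auto simp: hom_def U1_def)

lemma e_mult_right [simp]:
  "\<lbrakk>k \<in> carrier K; l \<in> carrier K; l' \<in> carrier K\<rbrakk> \<Longrightarrow> e k (l \<otimes> l') = e k l * e k l'"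
  using hom_right[of k] by (auto simp: hom_def U1_def)

lemma e_nonzero [simp]: "\<lbrakk>k \<in> carrier K; l \<in> carrier K\<rbrakk> \<Longrightarrow> e k l \<noteq> 0"
  using hom_right[of k] by (force simp: hom_def U1_def Pi_iff)

lemma e_one_left [simp]: "l \<in> carrier K \<Longrightarrow> e \<one> l = 1"
  using e_mult_left[of \<one> \<one> l] by simp

lemma e_one_right [simp]: "k \<in> carrier K \<Longrightarrow> e k \<one> = 1"
  using e_mult_right[of k \<one> \<one>] by simp

lemma e_inv_left [simp]:
  assumes "k \<in> carrier K" "l \<in> carrier K"
  shows "e (inv k) l = inverse (e k l)"
proof -
  have "e (inv k) l * e k l = 1"
    using assms e_mult_left[of "inv k" k l] by (simp del: e_mult_left)
  then show ?thesis
    using assms by (simp add: field_simps)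
qed

lemma e_inv_right [simp]:
  assumes "k \<in> carrier K" "l \<in> carrier K"
  shows "e k (inv l) = inverse (e k l)"
proof -
  have "e k (inv l) * e k l = 1"
    using assms e_mult_right[of k "inv l" l] by (simp del: e_mult_right)
  then show ?thesis
    using assms by (simp add: field_simps)
qed

lemma e_pow_left [simp]:
  "\<lbrakk>k \<in> carrier K; l \<in> carrier K\<rbrakk> \<Longrightarrow> e (k [^] (n::nat)) l = e k l ^ n"
  by (induction n) auto

lemma e_pow_right [simp]:
  "\<lbrakk>k \<in> carrier K; l \<in> carrier K\<rbrakk> \<Longrightarrow> e k (l [^] (n::nat)) = e k l ^ n"
  by (induction n) auto

text \<open>Expand \<open>e (k \<otimes> l) (k \<otimes> l) = 1\<close>; the diagonal terms are \<open>1\<close>.\<close>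

lemma e_swap:
  assumes "k \<in> carrier K" "l \<in> carrier K"
  shows "e l k = inverse (e k l)"
proof -
  have "e (k \<otimes> l) (k \<otimes> l) = e l k * e k l"
    using assms by (simp del: e_self add: e_self[of k] e_self[of l])
  then have "e l k * e k l = 1"
    using assms by simp
  then show ?thesis
    using assms by (simp add: field_simps)
qed

definition perp :: "'a set \<Rightarrow> 'a set"
  where "perp S = {k \<in> carrier K. \<forall>s\<in>S. e s k = 1}"

lemma subgroup_perp: "S \<subseteq> carrier K \<Longrightarrow> subgroup (perp S) K"
  by (rule subgroupI) (auto simp: perp_def subset_iff)

text \<open>
  Since \<open>e l k\<close> is the inverse of \<open>e k l\<close>, orthogonality does not depend on the order of the
  arguments.  Together with the fact that a complement is a subgroup, this lets orthogonality
  pass from generators to the generated subgroups, on either side.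
\<close>

lemma perp_sym:
  assumes "S \<subseteq> perp T" and "T \<subseteq> carrier K"
  shows "T \<subseteq> perp S"
  using assms e_swap unfolding perp_def by (fastforce simp: subset_iff)

lemma generate_subset_perp:
  assumes "S \<subseteq> perp T" and "T \<subseteq> carrier K"
  shows "generate K S \<subseteq> perp T"
  by (rule generate_subgroup_incl[OF assms(1) subgroup_perp[OF assms(2)]])

lemma generate_isotropic:
  assumes "S \<subseteq> perp S"
  shows "generate K S \<subseteq> perp (generate K S)"
proof -
  have "S \<subseteq> carrier K"
    using assms by (auto simp: perp_def)
  then show ?thesis
    using generate_subset_perp perp_sym generate_incl assms by metis
qed

text \<open>
  An element orthogonal to everything has the trivial character as its image under \<open>flat\<close>, so
  it is trivial by the injectivity half of the non-degeneracy.
\<close>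

lemma perp_carrier: "perp (carrier K) = {\<one>}"
proof -
  have "k = \<one>" if "k \<in> perp (carrier K)" for k
  proof (rule inj_onD[of "flat K e" "carrier K"])
    show "inj_on (flat K e) (carrier K)"
      using nondeg by (auto simp: nondegenerate_def iso_def bij_betw_def)
    show "flat K e k = flat K e \<one>"
      using that by (auto simp: flat_def perp_def intro!: restrict_ext)
  qed (use that in \<open>auto simp: perp_def\<close>)
  then show ?thesis
    by (auto simp: perp_def)
qed

text \<open>This is the surjectivity half of the non-degeneracy, without the restriction to the carrier.\<close>

lemma character_eq_e:
  assumes "h \<in> hom K U1"
  shows "\<exists>l\<in>carrier K. \<forall>k\<in>carrier K. h k = e k l"
proof -
  have "restrict h (carrier K) \<in> carrier (dual_group K)"
    using assms by (auto simp: dual_group_def hom_def)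
  then obtain l where "l \<in> carrier K" "restrict h (carrier K) = flat K e l"
    using nondeg by (auto simp: nondegenerate_def iso_def bij_betw_def image_iff)
  then show ?thesis
    by (metis flat_def restrict_apply')
qed

section \<open>Splitting off hyperbolic pairs\<close>

lemma values_eq_roots_unity:
  assumes "subgroup P K" and "x \<in> carrier K"
  shows "e x ` P = {z. z ^ card (e x ` P) = 1}"
proof (rule finite_subgroup_U1_eq_roots_unity)
  interpret group_hom K U1 "e x"
    using hom_right[OF assms(2)] comm_group_U1
    by (simp add: group_hom_def group_hom_axioms_def is_group comm_group_def)
  show "subgroup (e x ` P) U1"
    by (rule subgroup_img_is_subgroup[OF assms(1)])
  show "finite (e x ` P)"
    using subgroup.subset[OF assms(1)] finite_carrier finite_subset by blast
qed

text \<open>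
  Choose \<open>x\<close> so that \<open>e x\<close> has as many values on \<open>P\<close> as possible, and \<open>y\<close> so that \<open>e x y\<close> generates
  the group of these values.  Then \<open>e y\<close> has the same values, and any \<open>p\<close> can be corrected by powers
  of \<open>x\<close> and \<open>y\<close>, because \<open>e x x = e y y = 1\<close> lets the two conditions be met independently.
\<close>

lemma hyperbolic_pair_exists:
  assumes P: "subgroup P K" and uv: "u \<in> P" "v \<in> P" "e u v \<noteq> 1"
  shows "\<exists>x\<in>P. \<exists>y\<in>P. e x y \<noteq> 1 \<and>
    (\<forall>p\<in>P. \<exists>(i::nat) (j::nat). \<exists>q\<in>P \<inter> perp {x, y}. p = x [^] i \<otimes> y [^] j \<otimes> q)"
proof -
  have carr: "p \<in> carrier K" if "p \<in> P" for p
    using that subgroup.mem_carrier[OF P] by blast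
  have finP: "finite P"
    using subgroup.subset[OF P] finite_carrier finite_subset by blast
  let ?N = "(\<lambda>w. card (e w ` P)) ` P"
  have "Max ?N \<in> ?N"
    using finP uv(1) by (intro Max_in) auto
  then obtain x where x: "x \<in> P" and xmax: "Max ?N = card (e x ` P)"
    by blast
  have max: "card (e w ` P) \<le> card (e x ` P)" if "w \<in> P" for w
    unfolding xmax[symmetric] using finP that by (intro Max_ge) auto
  define m where "m = card (e x ` P)"
  have mpos: "0 < card (e w ` P)" if "w \<in> P" for w
    using that finP by (auto simp: card_gt_0_iff)
  obtain \<zeta> :: complex where \<zeta>: "\<zeta> ^ m = 1" and gen: "\<And>z. z ^ m = 1 \<Longrightarrow> \<exists>i::nat. z = \<zeta> ^ i"
    using primitive_root_unity_exists[OF mpos[OF x]] unfolding m_def by blast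
  have valx: "e x ` P = {z. z ^ m = 1}"
    using values_eq_roots_unity[OF P carr[OF x]] by (simp add: m_def)
  then have "\<zeta> \<in> e x ` P"
    using \<zeta> by simp
  then obtain y where y: "y \<in> P" and xy: "e x y = \<zeta>"
    by blast
  \<comment> \<open>The values of \<open>e y\<close> are the roots of unity of some order and include the inverse of \<open>\<zeta>\<close>,
    so they include all powers of \<open>\<zeta>\<close>; by maximality there are no others.\<close>
  define n where "n = card (e y ` P)"
  have valy: "e y ` P = {z. z ^ n = 1}"
    using values_eq_roots_unity[OF P carr[OF y]] by (simp add: n_def)
  have "inverse \<zeta> \<in> e y ` P"
    using e_swap[OF carr[OF x] carr[OF y]] x xy by (metis imageI)
  then have "\<zeta> ^ n = 1"
    by (simp add: valy power_inverse)
  then have sub: "e x ` P \<subseteq> e y ` P"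
  proof -
    have "(\<zeta> ^ i) ^ n = 1" for i
      using \<open>\<zeta> ^ n = 1\<close> by (metis mult.commute power_mult power_one)
    then show ?thesis
      unfolding valx valy using gen by blast
  qed
  have valy': "e y ` P = e x ` P"
    using card_seteq[OF _ sub] max[OF y] finP by auto
  \<comment> \<open>This is where \<open>e u v \<noteq> 1\<close> enters: \<open>e u\<close> has at least the two values \<open>1\<close> and \<open>e u v\<close>.\<close>
  have \<zeta>1: "\<zeta> \<noteq> 1"
  proof
    assume "\<zeta> = 1"
    then have "e x ` P \<subseteq> {1}"
      unfolding valx using gen by fastforce
    then have "card (e u ` P) \<le> 1"
      using max[OF uv(1)] card_mono[of "{1}" "e x ` P"] by simp
    moreover have "card {e u v, e u \<one>} \<le> card (e u ` P)"
      using uv finP subgroup.one_closed[OF P] by (intro card_mono) auto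
    ultimately show False
      using uv carr by simp
  qed
  show ?thesis
  proof (rule bexI[OF _ x], rule bexI[OF _ y], intro conjI ballI)
    show "e x y \<noteq> 1"
      using xy \<zeta>1 by simp
    fix p assume p: "p \<in> P"
    have "e x p ^ m = 1"
      using p valx by blast
    moreover have "e y p ^ m = 1"
      using p valx valy' by blast
    then have "e p y ^ m = 1"
      using e_swap[OF carr[OF y] carr[OF p]] by (simp add: power_inverse)
    ultimately obtain i j :: nat where ij: "e p y = \<zeta> ^ i" "e x p = \<zeta> ^ j"
      using gen by blast
    \<comment> \<open>With these exponents, \<open>w\<close> pairs with \<open>x\<close> and \<open>y\<close> exactly as \<open>p\<close> does.\<close>
    define w where "w = x [^] i \<otimes> y [^] j"
    have cs: "x \<in> carrier K" "y \<in> carrier K" "p \<in> carrier K"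
      using x y p carr by auto
    have "a [^] (i::nat) \<in> P" if "a \<in> P" for a i
      by (induction i) (use that P in \<open>auto simp: subgroup.one_closed subgroup.m_closed\<close>)
    then have "w \<in> P"
      using x y P by (simp add: w_def subgroup.m_closed)
    then have wP: "w \<in> carrier K" "inv w \<otimes> p \<in> P"
      using P p carr by (auto intro: subgroup.m_closed subgroup.m_inv_closed)
    have nz: "\<zeta> \<noteq> 0"
      using xy cs e_nonzero by auto
    have "e x w = \<zeta> ^ j" "e w y = \<zeta> ^ i"
      using cs xy by (simp_all add: w_def)
    then have "e x (inv w \<otimes> p) = 1" "e (inv w \<otimes> p) y = 1"
      using cs wP(1) nz by (simp_all add: ij)
    then have "inv w \<otimes> p \<in> perp {x, y}"
      using e_swap[of "inv w \<otimes> p" y] cs wP(1) by (simp add: perp_def)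
    moreover have "p = w \<otimes> (inv w \<otimes> p)"
      using cs wP(1) by (simp add: m_assoc[symmetric])
    ultimately show "\<exists>(i::nat) (j::nat). \<exists>q\<in>P \<inter> perp {x, y}. p = x [^] i \<otimes> y [^] j \<otimes> q"
      using wP(2) unfolding w_def by blast
  qed
qed

text \<open>
  This is the invariant of the construction: \<open>A\<close> and \<open>B\<close> are the parts built so far and \<open>P\<close> is what
  remains to be split.  The decomposition of an element is not required to be unique; when \<open>P\<close> is
  trivial, uniqueness follows from the non-degeneracy.
\<close>

definition isotropic_splitting :: "'a set \<Rightarrow> 'a set \<Rightarrow> 'a set \<Rightarrow> bool"
  where "isotropic_splitting A B P \<longleftrightarrow>
    subgroup A K \<and> subgroup B K \<and> subgroup P K \<and>
    A \<subseteq> perp (A \<union> P) \<and> B \<subseteq> perp (B \<union> P) \<and>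
    (\<forall>k\<in>carrier K. \<exists>a\<in>A. \<exists>b\<in>B. \<exists>p\<in>P. k = a \<otimes> b \<otimes> p)"

text \<open>
  The form restricted to \<open>P\<close> is again non-degenerate: \<open>P\<close> is orthogonal to \<open>A\<close> and \<open>B\<close>, so an element
  of \<open>P\<close> that is orthogonal to \<open>P\<close> is orthogonal to all of \<open>K\<close>.
\<close>

lemma isotropic_splitting_radical:
  assumes "isotropic_splitting A B P" and "z \<in> P" and "z \<in> perp P"
  shows "z = \<one>"
proof -
  have "e k z = 1" if k: "k \<in> carrier K" for k
  proof -
    obtain a b p where abp: "a \<in> A" "b \<in> B" "p \<in> P" "k = a \<otimes> b \<otimes> p"
      using assms(1) k by (auto simp: isotropic_splitting_def)
    have "a \<in> perp (A \<union> P)" "b \<in> perp (B \<union> P)" "subgroup P K"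
      using assms(1) abp(1,2) unfolding isotropic_splitting_def by (simp_all add: subset_iff)
    then have carr: "a \<in> carrier K" "b \<in> carrier K" "p \<in> carrier K"
      and za: "e z a = 1" and zb: "e z b = 1"
      using assms(2) abp(3) by (auto simp: perp_def dest: subgroup.mem_carrier)
    have z: "z \<in> carrier K" "e p z = 1"
      using assms(3) abp(3) by (auto simp: perp_def)
    have "e a z = 1" "e b z = 1"
      using e_swap[OF z(1) carr(1)] e_swap[OF z(1) carr(2)] za zb by simp_all
    then show ?thesis
      using carr z by (simp add: abp(4))
  qed
  then have "z \<in> perp (carrier K)"
    using assms(3) by (auto simp: perp_def)
  then show ?thesis
    by (simp add: perp_carrier)
qed

text \<open>
  A nontrivial \<open>P\<close> contains a hyperbolic pair \<open>x\<close>, \<open>y\<close>; adjoin \<open>x\<close> to \<open>A\<close> and \<open>y\<close> to \<open>B\<close>, and keep the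
  elements of \<open>P\<close> orthogonal to both.  The element \<open>y\<close> itself drops out of \<open>P\<close>.
\<close>

lemma isotropic_splitting_step:
  assumes split: "isotropic_splitting A B P" and "P \<noteq> {\<one>}"
  obtains A' B' P' where "isotropic_splitting A' B' P'" and "P' \<subset> P"
proof -
  have A: "subgroup A K" "A \<subseteq> perp (A \<union> P)" and B: "subgroup B K" "B \<subseteq> perp (B \<union> P)"
    and P: "subgroup P K"
    and decomp: "\<And>k. k \<in> carrier K \<Longrightarrow> \<exists>a\<in>A. \<exists>b\<in>B. \<exists>p\<in>P. k = a \<otimes> b \<otimes> p"
    using split by (auto simp: isotropic_splitting_def)
  have sub: "A \<subseteq> carrier K" "B \<subseteq> carrier K" "P \<subseteq> carrier K"
    using A B P by (auto dest: subgroup.subset)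
  obtain v where v: "v \<in> P" "v \<noteq> \<one>"
    using assms(2) subgroup.one_closed[OF P] by blast
  then have "v \<notin> perp P"
    using isotropic_splitting_radical[OF split] by blast
  then obtain u where u: "u \<in> P" "e u v \<noteq> 1"
    using v sub by (auto simp: perp_def)
  obtain x y where x: "x \<in> P" and y: "y \<in> P" and xy: "e x y \<noteq> 1"
    and red: "\<forall>p\<in>P. \<exists>(i::nat) (j::nat). \<exists>q\<in>P \<inter> perp {x, y}. p = x [^] i \<otimes> y [^] j \<otimes> q"
    using hyperbolic_pair_exists[OF P u(1) v(1) u(2)] by auto
  define A' where "A' = generate K (insert x A)"
  define B' where "B' = generate K (insert y B)"
  define P' where "P' = P \<inter> perp {x, y}"
  have xyc: "x \<in> carrier K" "y \<in> carrier K"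
    using x y sub by auto
  have P'sub: "P' \<subseteq> carrier K"
    using sub by (auto simp: P'_def)
  \<comment> \<open>The same argument serves for \<open>x\<close> with \<open>A\<close> and for \<open>y\<close> with \<open>B\<close>.\<close>
  have isotropic: "generate K (insert w C) \<subseteq> perp (generate K (insert w C) \<union> P')"
    if w: "w \<in> {x, y}" and C: "C \<subseteq> perp (C \<union> P)" for w C
  proof -
    have wP: "w \<in> P" "w \<in> carrier K"
      using w x y xyc by auto
    have Cc: "C \<subseteq> carrier K"
      using C by (auto simp: perp_def)
    have C1: "C \<subseteq> perp C" "C \<subseteq> perp P"
      using C by (auto simp: perp_def)
    then have "w \<in> perp C"
      using perp_sym[OF C1(2) sub(3)] wP by auto
    then have "insert w C \<subseteq> perp (insert w C)"
      using C1 wP by (auto simp: perp_def)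
    then have 1: "generate K (insert w C) \<subseteq> perp (generate K (insert w C))"
      by (rule generate_isotropic)
    have "P' \<subseteq> perp (insert w C)"
      using perp_sym[OF C1(2) sub(3)] w by (auto simp: P'_def perp_def)
    then have "insert w C \<subseteq> perp P'"
      by (rule perp_sym) (use wP Cc in auto)
    then have "generate K (insert w C) \<subseteq> perp P'"
      by (rule generate_subset_perp[OF _ P'sub])
    then show ?thesis
      using 1 by (auto simp: perp_def)
  qed
  have A's: "subgroup A' K" and B's: "subgroup B' K"
    using sub xyc by (auto simp: A'_def B'_def intro!: generate_is_subgroup)
  have pow_gen: "c \<otimes> w [^] (i::nat) \<in> generate K (insert w C)"
    if "w \<in> carrier K" "C \<subseteq> carrier K" "c \<in> C" for c w C i
  proof -
    have "w [^] i \<in> generate K (insert w C)"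
      by (induction i) (auto intro: generate.intros)
    then show ?thesis
      using that by (auto intro: generate.intros)
  qed
  have decomp': "\<exists>a\<in>A'. \<exists>b\<in>B'. \<exists>q\<in>P'. k = a \<otimes> b \<otimes> q" if k: "k \<in> carrier K" for k
  proof -
    obtain a b p where abp: "a \<in> A" "b \<in> B" "p \<in> P" "k = a \<otimes> b \<otimes> p"
      using decomp[OF k] by blast
    obtain i j :: nat and q where q: "q \<in> P'" "p = x [^] i \<otimes> y [^] j \<otimes> q"
      using bspec[OF red abp(3)] unfolding P'_def by auto
    have "a \<in> carrier K" "b \<in> carrier K" "q \<in> carrier K"
      using abp q sub P'sub by auto
    then have "k = (a \<otimes> x [^] i) \<otimes> (b \<otimes> y [^] j) \<otimes> q"
      using xyc by (simp add: abp(4) q(2) m_ac)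
    moreover have "a \<otimes> x [^] i \<in> A'" "b \<otimes> y [^] j \<in> B'"
      using pow_gen xyc sub abp by (auto simp: A'_def B'_def)
    ultimately show ?thesis
      using q by blast
  qed
  show thesis
  proof
    show "isotropic_splitting A' B' P'"
      unfolding isotropic_splitting_def
    proof (intro conjI)
      show "subgroup P' K"
        unfolding P'_def using P xyc by (intro subgroups_Inter_pair subgroup_perp) auto
      show "A' \<subseteq> perp (A' \<union> P')" "B' \<subseteq> perp (B' \<union> P')"
        using isotropic A B by (auto simp: A'_def B'_def)
    qed (use A's B's decomp' in auto)
    show "P' \<subset> P"
      using xy y by (auto simp: P'_def perp_def)
  qed
qed

lemma isotropic_splitting_complete:
  assumes "isotropic_splitting A B P"
  shows "\<exists>A' B'. isotropic_splitting A' B' {\<one>}"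
  using assms
proof (induction "card P" arbitrary: A B P rule: less_induct)
  case less
  show ?case
  proof (cases "P = {\<one>}")
    case False
    then obtain A' B' P' where step: "isotropic_splitting A' B' P'" "P' \<subset> P"
      using isotropic_splitting_step[OF less.prems] by blast
    have "finite P"
      using less.prems finite_carrier
      by (auto simp: isotropic_splitting_def dest: subgroup.subset intro: finite_subset)
    then show ?thesis
      using less.hyps[OF psubset_card_mono step(1)] step(2) by blast
  qed (use less.prems in blast)
qed

lemma lagrangian_decomposition:
  obtains A B where "subgroup A K" and "subgroup B K" and "A \<subseteq> perp A" and "B \<subseteq> perp B"
    and "carrier K = A <#> B"
proof -
  have "isotropic_splitting {\<one>} {\<one>} (carrier K)"
    unfolding isotropic_splitting_def
    using subgroup_self triv_subgroup by (auto simp: perp_def)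
  then obtain A B where AB: "isotropic_splitting A B {\<one>}"
    using isotropic_splitting_complete by blast
  then have s: "A \<subseteq> carrier K" "B \<subseteq> carrier K"
    using subgroup.subset by (auto simp: isotropic_splitting_def)
  have "\<exists>a\<in>A. \<exists>b\<in>B. k = a \<otimes> b" if k: "k \<in> carrier K" for k
  proof -
    obtain a b where ab: "a \<in> A" "b \<in> B" "k = a \<otimes> b \<otimes> \<one>"
      using AB k by (auto simp: isotropic_splitting_def)
    then have "k = a \<otimes> b"
      using s by (simp add: subset_iff)
    then show ?thesis
      using ab by blast
  qed
  then have "carrier K = A <#> B"
    using s by (auto simp: set_mult_def)
  moreover have "A \<subseteq> perp A" "B \<subseteq> perp B" "subgroup A K" "subgroup B K"
    using AB by (simp_all add: isotropic_splitting_def perp_def subset_iff)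
  ultimately show thesis
    using that by blast
qed

section \<open>The second factor as the dual of the first\<close>

text \<open>
  As \<open>A\<close> and \<open>B\<close> together generate \<open>K\<close>, this is again non-degeneracy.  It gives both the directness of
  the product and the injectivity of the map from \<open>B\<close> to the dual of \<open>A\<close>.
\<close>

lemma perp_Int_perp:
  assumes "A \<subseteq> carrier K" and "B \<subseteq> carrier K" and "carrier K = A <#> B"
  shows "perp A \<inter> perp B \<subseteq> {\<one>}"
proof
  fix z assume z: "z \<in> perp A \<inter> perp B"
  have "e k z = 1" if k: "k \<in> carrier K" for k
  proof -
    obtain a b where ab: "a \<in> A" "b \<in> B" "k = a \<otimes> b"
      using k unfolding assms(3) set_mult_def by blast
    then have "a \<in> carrier K" "b \<in> carrier K"
      using assms(1,2) by auto
    then show ?thesis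
      using z ab by (simp add: perp_def)
  qed
  then show "z \<in> {\<one>}"
    using z perp_carrier by (auto simp: perp_def)
qed

lemma lagrangians_disjoint:
  assumes "A \<subseteq> perp A" and "B \<subseteq> perp B" and "carrier K = A <#> B"
  shows "A \<inter> B \<subseteq> {\<one>}"
proof -
  have "A \<subseteq> carrier K" "B \<subseteq> carrier K"
    using assms(1,2) by (auto simp: perp_def)
  then show ?thesis
    using perp_Int_perp[OF _ _ assms(3)] assms(1,2) by blast
qed

text \<open>Compose the character with the projection of \<open>K = A \<times> B\<close> onto \<open>A\<close>.\<close>

lemma character_extension:
  assumes "subgroup A K" and "subgroup B K" and "A \<inter> B \<subseteq> {\<one>}" and "carrier K = A <#> B"
    and "\<chi> \<in> hom (K\<lparr>carrier := A\<rparr>) U1"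
  shows "\<exists>h\<in>hom K U1. \<forall>a\<in>A. h a = \<chi> a"
proof -
  interpret group_disjoint_sum K A B
    using assms by (simp add: group_disjoint_sum_def is_group)
  define pr where "pr k = (THE a. a \<in> A \<and> (\<exists>b\<in>B. k = a \<otimes> b))" for k
  note uniq = cancel[THEN iffD1, OF assms(3), rule_format]
  have pr: "pr (a \<otimes> b) = a" if ab: "a \<in> A" "b \<in> B" for a b
    unfolding pr_def
  proof (rule the_equality)
    show "a \<in> A \<and> (\<exists>b'\<in>B. a \<otimes> b = a \<otimes> b')"
      using ab by blast
    show "a' = a" if "a' \<in> A \<and> (\<exists>b'\<in>B. a \<otimes> b = a' \<otimes> b')" for a'
      using that uniq[OF ab] by metis
  qed
  show ?thesis
  proof (rule bexI[of _ "\<lambda>k. \<chi> (pr k)"])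
    have "\<chi> (pr (k \<otimes> l)) = \<chi> (pr k) * \<chi> (pr l) \<and> cmod (\<chi> (pr k)) = 1"
      if kl: "k \<in> carrier K" "l \<in> carrier K" for k l
    proof -
      obtain a b a' b' where ab: "a \<in> A" "b \<in> B" "k = a \<otimes> b" "a' \<in> A" "b' \<in> B" "l = a' \<otimes> b'"
        using kl unfolding assms(4) set_mult_def by blast
      then have "k \<otimes> l = (a \<otimes> a') \<otimes> (b \<otimes> b')"
        by (simp add: m_ac)
      then have "pr (k \<otimes> l) = a \<otimes> a'"
        using ab pr[of "a \<otimes> a'" "b \<otimes> b'"] by simp
      moreover have "pr k = a" "pr l = a'"
        using ab by (simp_all add: pr)
      ultimately show ?thesis
        using assms(5) ab by (auto simp: hom_def U1_def)
    qed
    then show "(\<lambda>k. \<chi> (pr k)) \<in> hom K U1"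
      by (auto simp: hom_def U1_def)
    show "\<forall>a\<in>A. \<chi> (pr a) = \<chi> a"
    proof
      fix a assume "a \<in> A"
      then show "\<chi> (pr a) = \<chi> a"
        using pr[of a \<one>] by simp
    qed
  qed
qed

text \<open>
  For the injectivity, a quotient of two elements of \<open>B\<close> with the same image is orthogonal to \<open>A\<close>,
  and also to \<open>B\<close> because \<open>B\<close> is isotropic.  For the surjectivity, an extension to \<open>K\<close> of a character
  of \<open>A\<close> is pairing with some \<open>a \<otimes> b\<close>, and \<open>a\<close> does not contribute on \<open>A\<close> because \<open>A\<close> is isotropic.
\<close>

lemma lagrangian_iso_dual:
  assumes A: "subgroup A K" "A \<subseteq> perp A" and B: "subgroup B K" "B \<subseteq> perp B"
    and AB: "carrier K = A <#> B"
  shows "(\<lambda>b. \<lambda>x\<in>A. e x b) \<in> iso (K\<lparr>carrier := B\<rparr>) (dual_group (K\<lparr>carrier := A\<rparr>))"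
proof (rule isoI)
  have Ac: "a \<in> carrier K" if "a \<in> A" for a
    using that subgroup.mem_carrier[OF A(1)] by blast
  have Bc: "b \<in> carrier K" if "b \<in> B" for b
    using that subgroup.mem_carrier[OF B(1)] by blast
  have dual: "(\<lambda>x\<in>A. e x b) \<in> carrier (dual_group (K\<lparr>carrier := A\<rparr>))" if "b \<in> B" for b
    using hom_left[OF Bc[OF that]] subgroup.m_closed[OF A(1)] Ac
    by (auto simp: dual_group_def hom_def Pi_iff)
  show "(\<lambda>b. \<lambda>x\<in>A. e x b) \<in> hom (K\<lparr>carrier := B\<rparr>) (dual_group (K\<lparr>carrier := A\<rparr>))"
    by (rule homI) (use dual Ac Bc in \<open>auto simp: dual_group_def U1_def intro!: restrict_ext\<close>)
  have inj: "b = b'" if b: "b \<in> B" "b' \<in> B" and eq: "(\<lambda>x\<in>A. e x b) = (\<lambda>x\<in>A. e x b')" for b b'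
  proof -
    have mem: "b \<otimes> inv b' \<in> B"
      using b B(1) by (simp add: subgroup.m_closed subgroup.m_inv_closed)
    have "e x (b \<otimes> inv b') = 1" if "x \<in> A" for x
      using fun_cong[OF eq, of x] that b Ac Bc by simp
    moreover have "e x (b \<otimes> inv b') = 1" if "x \<in> B" for x
      using B(2) mem that by (auto simp: perp_def)
    ultimately have "b \<otimes> inv b' \<in> perp A \<inter> perp B"
      using Bc[OF mem] by (simp add: perp_def)
    then have "b \<otimes> inv b' = \<one>"
      using perp_Int_perp[OF _ _ AB] Ac Bc by blast
    then show ?thesis
      using b Bc by (metis inv_closed inv_equality inv_inv)
  qed
  have surj: "\<exists>b\<in>B. \<chi> = (\<lambda>x\<in>A. e x b)" if \<chi>: "\<chi> \<in> carrier (dual_group (K\<lparr>carrier := A\<rparr>))" for \<chi>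
  proof -
    have ext: "\<chi> \<in> hom (K\<lparr>carrier := A\<rparr>) U1" "\<chi> \<in> extensional A"
      using \<chi> by (auto simp: dual_group_def)
    obtain h where h: "h \<in> hom K U1" "\<And>a. a \<in> A \<Longrightarrow> h a = \<chi> a"
      using character_extension[OF A(1) B(1) lagrangians_disjoint[OF A(2) B(2) AB] AB ext(1)]
      by blast
    obtain l where l: "l \<in> carrier K" "\<And>k. k \<in> carrier K \<Longrightarrow> h k = e k l"
      using character_eq_e[OF h(1)] by blast
    obtain a b where ab: "a \<in> A" "b \<in> B" "l = a \<otimes> b"
      using l(1) unfolding AB set_mult_def by blast
    have "\<chi> x = e x b" if "x \<in> A" for x
    proof -
      have "e x a = 1"
        using A(2) that ab(1) by (auto simp: perp_def)
      then show ?thesis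
        using h(2)[OF that] l(2)[OF Ac[OF that]] that ab Ac Bc by simp
    qed
    then show ?thesis
      using ext(2) ab(2) by (intro bexI[of _ b]) (auto simp: extensional_def)
  qed
  show "bij_betw (\<lambda>b. \<lambda>x\<in>A. e x b) (carrier (K\<lparr>carrier := B\<rparr>))
      (carrier (dual_group (K\<lparr>carrier := A\<rparr>)))"
  proof (rule bij_betw_imageI)
    show "inj_on (\<lambda>b. \<lambda>x\<in>A. e x b) (carrier (K\<lparr>carrier := B\<rparr>))"
      using inj by (auto intro!: inj_onI)
    show "(\<lambda>b. \<lambda>x\<in>A. e x b) ` carrier (K\<lparr>carrier := B\<rparr>)
        = carrier (dual_group (K\<lparr>carrier := A\<rparr>))"
      using dual surj by (intro equalityI subsetI) (simp_all add: image_iff, blast)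
  qed
qed

end

theorem theorem4p1:
  fixes K :: "('a, 'b) monoid_scheme" and e :: "'a \<Rightarrow> 'a \<Rightarrow> complex"
  assumes "comm_group K" and "finite (carrier K)"
    and "alternating_bicharacter K e" and "nondegenerate K e"
  shows "\<exists>(A :: 'a monoid) \<phi>.
    comm_group A \<and> finite (carrier A) \<and>
    \<phi> \<in> iso (A \<times>\<times> dual_group A) K \<and>
    (\<forall>x\<in>carrier A. \<forall>x'\<in>carrier A.
      \<forall>\<chi>\<in>carrier (dual_group A). \<forall>\<chi>'\<in>carrier (dual_group A).
        e (\<phi> (x, \<chi>)) (\<phi> (x', \<chi>')) = \<chi>' x * inverse (\<chi> x'))"
proof -
  interpret finite_symplectic_group K e
    using assms by (simp add: finite_symplectic_group_def finite_symplectic_group_axioms_def)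
  obtain A B where A: "subgroup A K" "A \<subseteq> perp A" and B: "subgroup B K" "B \<subseteq> perp B"
    and AB: "carrier K = A <#>\<^bsub>K\<^esub> B"
    by (rule lagrangian_decomposition)
  interpret group_disjoint_sum K A B
    using A B by (simp add: group_disjoint_sum_def is_group)
  note uniq = cancel[THEN iffD1, OF lagrangians_disjoint[OF A(2) B(2) AB], rule_format]
  \<comment> \<open>The type \<open>'a monoid\<close> has no room for the additional record fields of \<open>K\<close>, so updating the
    carrier of \<open>K\<close> would not do.\<close>
  define G where "G = \<lparr>carrier = A, monoid.mult = monoid.mult K, monoid.one = monoid.one K\<rparr>"
  have G: "carrier G = A" "\<And>x y. x \<otimes>\<^bsub>G\<^esub> y = x \<otimes>\<^bsub>K\<^esub> y"
    by (simp_all add: G_def)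
  have dual_G: "dual_group (K\<lparr>carrier := A\<rparr>) = dual_group G"
    by (simp add: dual_group_def hom_def G_def)
  have "comm_group G"
  proof (rule comm_groupI)
    fix x assume "x \<in> carrier G"
    then show "\<exists>y\<in>carrier G. y \<otimes>\<^bsub>G\<^esub> x = \<one>\<^bsub>G\<^esub>"
      by (intro bexI[of _ "inv\<^bsub>K\<^esub> x"]) (auto simp: G_def)
  qed (auto simp: G_def m_ac)
  define \<beta> where "\<beta> = inv_into B (\<lambda>b. \<lambda>x\<in>A. e x b)"
  note iso = lagrangian_iso_dual[OF A B AB, unfolded dual_G]
  have "\<beta> \<in> iso (dual_group G) (K\<lparr>carrier := B\<rparr>)"
    using group.iso_set_sym[OF subgroup_imp_group[OF B(1)] iso] by (simp add: \<beta>_def)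
  then have \<beta>_mult: "\<And>\<chi> \<chi>'. \<lbrakk>\<chi> \<in> carrier (dual_group G); \<chi>' \<in> carrier (dual_group G)\<rbrakk>
        \<Longrightarrow> \<beta> (\<chi> \<otimes>\<^bsub>dual_group G\<^esub> \<chi>') = \<beta> \<chi> \<otimes>\<^bsub>K\<^esub> \<beta> \<chi>'"
    and \<beta>_bij: "bij_betw \<beta> (carrier (dual_group G)) B"
    by (auto simp: iso_def hom_def)
  then have \<beta>B: "\<And>\<chi>. \<chi> \<in> carrier (dual_group G) \<Longrightarrow> \<beta> \<chi> \<in> B"
    by (auto dest: bij_betwE)
  have \<beta>_eq: "e x (\<beta> \<chi>) = \<chi> x" if "\<chi> \<in> carrier (dual_group G)" "x \<in> A" for \<chi> x
  proof -
    have "(\<lambda>b. \<lambda>x\<in>A. e x b) ` B = carrier (dual_group G)"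
      using iso by (auto simp: iso_def bij_betw_def)
    then have "(\<lambda>x\<in>A. e x (\<beta> \<chi>)) = \<chi>"
      unfolding \<beta>_def using that(1) f_inv_into_f[of \<chi> "\<lambda>b. \<lambda>x\<in>A. e x b" B] by simp
    then show ?thesis
      using that(2) by (metis restrict_apply')
  qed
  define \<phi> where "\<phi> = (\<lambda>(x, \<chi>). x \<otimes>\<^bsub>K\<^esub> \<beta> \<chi>)"
  have "\<phi> \<in> iso (G \<times>\<times> dual_group G) K"
  proof (rule isoI)
    show "\<phi> \<in> hom (G \<times>\<times> dual_group G) K"
      by (rule homI) (auto simp: \<phi>_def G \<beta>B \<beta>_mult m_ac)
    have "x = x' \<and> \<chi> = \<chi>'"
      if *: "x \<in> A" "\<chi> \<in> carrier (dual_group G)" "x' \<in> A" "\<chi>' \<in> carrier (dual_group G)"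
        "x \<otimes>\<^bsub>K\<^esub> \<beta> \<chi> = x' \<otimes>\<^bsub>K\<^esub> \<beta> \<chi>'" for x x' \<chi> \<chi>'
      using uniq[of x "\<beta> \<chi>" x' "\<beta> \<chi>'"] * \<beta>B inj_onD[OF bij_betw_imp_inj_on[OF \<beta>_bij], of \<chi> \<chi>']
      by simp
    then have "inj_on \<phi> (A \<times> carrier (dual_group G))"
      by (auto simp: \<phi>_def inj_on_def)
    moreover have "\<phi> ` (A \<times> carrier (dual_group G)) = A <#>\<^bsub>K\<^esub> \<beta> ` carrier (dual_group G)"
      by (force simp: \<phi>_def set_mult_def)
    ultimately show "bij_betw \<phi> (carrier (G \<times>\<times> dual_group G)) (carrier K)"
      using bij_betw_imp_surj_on[OF \<beta>_bij] by (simp add: bij_betw_def G AB)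
  qed
  moreover have "e (\<phi> (x, \<chi>)) (\<phi> (x', \<chi>')) = \<chi>' x * inverse (\<chi> x')"
    if "x \<in> A" "x' \<in> A" "\<chi> \<in> carrier (dual_group G)" "\<chi>' \<in> carrier (dual_group G)" for x x' \<chi> \<chi>'
  proof -
    have "e x x' = 1" "e (\<beta> \<chi>) (\<beta> \<chi>') = 1"
      using A(2) B(2) \<beta>B[OF that(3)] \<beta>B[OF that(4)] that by (auto simp: perp_def)
    moreover have "e (\<beta> \<chi>) x' = inverse (\<chi> x')"
      using e_swap[of x' "\<beta> \<chi>"] \<beta>_eq[of \<chi> x'] \<beta>B that by simp
    ultimately show ?thesis
      using that \<beta>B \<beta>_eq by (simp add: \<phi>_def)
  qed
  moreover have "finite (carrier G)"
    using finite_carrier AG.subset finite_subset by (auto simp: G)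
  ultimately show ?thesis
    using \<open>comm_group G\<close> unfolding G(1)[symmetric] by blast
qed

end
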